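(* For $v\equiv 1$ or $3\pmod 6$, $|\mathrm{Int}_\Phi(\{3\},1^v)|=\Theta(v^3)$. That is, there exist constants $c_1,c_2>0$ and $v_0$ such that for every integer $v\geq v_0$ with $v\equiv 1$ or $3\pmod 6$, $c_1v^3\leq|\mathrm{Int}_\Phi(\{3\},1^v)|\leq c_2v^3$.
   Context: A Steiner triple system of order $v$, denoted STS$(v)$, is a pair $(X,\mathcal{A})$ where $X$ is a set of $v$ points and $\mathcal{A}$ is a set of 3-subsets of $X$ (blocks) such that every 2-subset of $X$ is contained in exactly one block. The intersection of two STS$(v)$ $(X,\mathcal{A}_1)$ and $(X,\mathcal{A}_2)$ on the same point set is the set of common blocks $\mathcal{A}_1\cap\mathcal{A}_2$. For a set $\mathcal{S}$ of 3-subsets of $X$, $\mathrm{supp}(\mathcal{S})=\bigcup_{S\in\mathcal{S}}S$ and $\Phi(\mathcal{S})=(|\mathrm{supp}(\mathcal{S})|,|\mathcal{S}|)\in\mathbb{Z}_{\geq 0}^2$. The set $\mathrm{Int}_\Phi(\{3\},1^v)\subseteq\mathbb{Z}^2_{\geq 0}$ is the set of all pairs $(m,n)$ for which there exist two (not necessarily distinct) STS$(v)$ on the same point set, $(X,\mathcal{A}_1)$ and $(X,\mathcal{A}_2)$, with $\Phi(\mathcal{A}_1\cap\mathcal{A}_2)=(m,n)$. *)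

theory Defs
  imports Complex_Main
begin

definition steiner_triple_system :: "nat \<Rightarrow> 'a set \<Rightarrow> 'a set set \<Rightarrow> bool" where
  "steiner_triple_system v X \<A> \<longleftrightarrow>
     finite X \<and> card X = v \<and>
     (\<forall>B\<in>\<A>. B \<subseteq> X \<and> card B = 3) \<and>
     (\<forall>P. P \<subseteq> X \<and> card P = 2 \<longrightarrow> (\<exists>!B. B \<in> \<A> \<and> P \<subseteq> B))"

definition supp :: "'a set set \<Rightarrow> 'a set" where
  "supp \<S> = \<Union>\<S>"

definition Phi :: "'a set set \<Rightarrow> nat \<times> nat" where
  "Phi \<S> = (card (supp \<S>), card \<S>)"

(* The point set X ranges over all v-element sets of natural numbers. Since a point set
   is finite and Phi is invariant under relabelling of the points, this gives the same
   set of pairs as letting X be an arbitrary v-element set. *)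
definition Int_Phi :: "nat \<Rightarrow> (nat \<times> nat) set" where
  "Int_Phi v = {(m, n). \<exists>(X :: nat set) \<A>\<^sub>1 \<A>\<^sub>2.
     steiner_triple_system v X \<A>\<^sub>1 \<and> steiner_triple_system v X \<A>\<^sub>2 \<and>
     Phi (\<A>\<^sub>1 \<inter> \<A>\<^sub>2) = (m, n)}"

end

theory Submission
  imports Defs
begin

text \<open>
The upper bound holds because an STS on \<open>v\<close> points has at most \<open>v\<^sup>2\<close> blocks, so the two
coordinates of \<open>Phi\<close> have \<open>v + 1\<close> and \<open>v\<^sup>2 + 1\<close> possible values.

For the lower bound write \<open>v = 6 * t + w\<close> with \<open>w\<close> equal to 1 or 3. The points are three
levels, each a copy of \<open>{0..<t} \<times> bool\<close>, and \<open>w\<close> points at infinity. Two points \<open>(i, a)\<close> and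
\<open>(j, b)\<close> of one level with \<open>i \<noteq> j\<close> are completed to a block by a point of the cyclically next
level which is determined by the sum \<open>i + j\<close> modulo \<open>t\<close> and by the bit \<open>a + b + h\<close>, where the
twist \<open>h\<close> is a bit that may be chosen freely for every level and every pair \<open>{i, j}\<close>: flipping
it merely switches a \<open>2 \<times> 2\<close> subsquare of a Latin square. All these choices leave the same
pairs of points uncovered (\<open>joined_next_level\<close>). The graph of the uncovered pairs (apart from
those at infinity) falls apart into isomorphic components of bounded size, one for each \<open>i\<close> if
\<open>t\<close> is odd and one for each \<open>i\<close> modulo \<open>t div 2\<close> if \<open>t\<close> is even, and four fixed graphs have to
be decomposed into triangles.

Two such systems have independently adjustable intersections. Let all twists of the first
system be 0, and those of the second be 1 except at the pairs of a set \<open>G\<close> on the bottom level.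
Decompose all components of the first system by a fixed \<open>D\<close>, and those of the second by \<open>D\<close> up
to component \<open>k\<close> and by another decomposition \<open>D'\<close> afterwards, where \<open>D\<close> and \<open>D'\<close> have no
common triangle at some point of the top level. The common blocks are four for each pair in
\<open>G\<close>, and those shared by the decompositions (\<open>system_Int\<close>). Enlarging \<open>G\<close> adds common blocks
but, as long as \<open>G\<close> contains the star of all \<open>{0, j}\<close>, does not affect the support
(\<open>supp_common\<close>); enlarging \<open>k\<close> strictly enlarges the support. Hence a linear number of support
sizes occurs, each with a quadratic number of block numbers (\<open>card_Int_Phi_ge\<close>), the pairs
being separated by strict inclusions of supports and of sets of common blocks.
\<close>

section \<open>Steiner triple systems: counting and relabelling\<close>

lemma steiner_iff:
  "steiner_triple_system v X A \<longleftrightarrow>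
     finite X \<and> card X = v \<and> (\<forall>B\<in>A. B \<subseteq> X \<and> card B = 3) \<and>
     (\<forall>x\<in>X. \<forall>y\<in>X. x \<noteq> y \<longrightarrow> (\<exists>!B. B \<in> A \<and> x \<in> B \<and> y \<in> B))"
proof -
  have "(\<forall>P. P \<subseteq> X \<and> card P = 2 \<longrightarrow> (\<exists>!B. B \<in> A \<and> P \<subseteq> B)) \<longleftrightarrow>
        (\<forall>x\<in>X. \<forall>y\<in>X. x \<noteq> y \<longrightarrow> (\<exists>!B. B \<in> A \<and> x \<in> B \<and> y \<in> B))" (is "?L = ?R")
  proof
    assume L: ?L
    show ?R
    proof (intro ballI impI)
      fix x y assume "x \<in> X" "y \<in> X" "x \<noteq> y"
      then have "{x, y} \<subseteq> X \<and> card {x, y} = 2" by simp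
      from L[rule_format, OF this] have "\<exists>!B. B \<in> A \<and> {x, y} \<subseteq> B" .
      then show "\<exists>!B. B \<in> A \<and> x \<in> B \<and> y \<in> B" by simp
    qed
  next
    assume R: ?R
    show ?L
    proof (intro allI impI)
      fix P assume P: "P \<subseteq> X \<and> card P = 2"
      then obtain x y where xy: "P = {x, y}" "x \<noteq> y" by (auto simp: card_2_iff)
      with P R have "\<exists>!B. B \<in> A \<and> x \<in> B \<and> y \<in> B" by simp
      then show "\<exists>!B. B \<in> A \<and> P \<subseteq> B" by (simp add: xy)
    qed
  qed
  then show ?thesis unfolding steiner_triple_system_def by simp
qed

lemma steiner_block_unique:
  assumes "steiner_triple_system v X A" "B \<in> A" "B' \<in> A"
    and "x \<in> B" "y \<in> B" "x \<in> B'" "y \<in> B'" "x \<noteq> y"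
  shows "B = B'"
proof -
  have S: "\<And>x y. x \<in> X \<Longrightarrow> y \<in> X \<Longrightarrow> x \<noteq> y \<Longrightarrow> \<exists>!B. B \<in> A \<and> x \<in> B \<and> y \<in> B" "B \<subseteq> X"
    using assms(1,2) unfolding steiner_iff by simp_all
  have "\<exists>!B. B \<in> A \<and> x \<in> B \<and> y \<in> B" by (rule S(1)) (use S(2) assms in auto)
  then show ?thesis using assms by (elim ex1E) metis
qed

definition pairs :: "'a set \<Rightarrow> 'a set set" where
  "pairs B = {P. P \<subseteq> B \<and> card P = 2}"

lemma finite_pairs: "finite B \<Longrightarrow> finite (pairs B)"
  unfolding pairs_def by (rule finite_subset[of _ "Pow B"]) auto

lemma card_pairs: "finite B \<Longrightarrow> card (pairs B) = card B choose 2"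
  unfolding pairs_def by (rule n_subsets)

lemma twice_card_pairs: "finite B \<Longrightarrow> 2 * card (pairs B) = card B * (card B - 1)"
proof -
  assume "finite B"
  moreover have "even (card B * (card B - 1))" by (cases "card B") auto
  ultimately show ?thesis by (simp add: card_pairs choose_two)
qed

lemma card_pairs_block: "card B = 3 \<Longrightarrow> card (pairs B) = 3"
  using card_pairs[of B] by (cases "finite B") (simp_all add: choose_two)

lemma pair_mem_pairs: "x \<in> B \<Longrightarrow> y \<in> B \<Longrightarrow> x \<noteq> y \<Longrightarrow> {x, y} \<in> pairs B"
  by (simp add: pairs_def)

text \<open>Uniqueness comes for free: the blocks cover each of the \<open>v * (v - 1) / 2\<close> pairs, and
contain only three pairs each, so a bound on their number leaves no room for a pair covered
twice.\<close>

lemma steiner_by_counting: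
  assumes fin: "finite X" and v: "card X = v"
    and blocks: "\<And>B. B \<in> A \<Longrightarrow> B \<subseteq> X \<and> card B = 3"
    and cover: "\<And>x y. x \<in> X \<Longrightarrow> y \<in> X \<Longrightarrow> x \<noteq> y \<Longrightarrow> \<exists>B\<in>A. x \<in> B \<and> y \<in> B"
    and few: "6 * card A \<le> v * (v - 1)"
  shows "steiner_triple_system v X A"
proof -
  have finA: "finite A" by (rule finite_subset[of _ "Pow X"]) (use blocks fin in auto)
  have finB: "finite B" if "B \<in> A" for B using blocks[OF that] fin finite_subset by blast
  have "B = B'" if B: "B \<in> A" "B' \<in> A" and xy: "x \<in> B" "y \<in> B" "x \<in> B'" "y \<in> B'" "x \<noteq> y" for B B' x y
  proof (rule ccontr)
    assume ne: "B \<noteq> B'"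
    \<comment> \<open>A repeated pair can be removed from one of its two blocks without uncovering anything.\<close>
    let ?Q = "(\<Union>C\<in>A - {B}. pairs C) \<union> (pairs B - {{x, y}})"
    have "pairs X \<subseteq> ?Q"
    proof
      fix P assume "P \<in> pairs X"
      then obtain p q where P: "P = {p, q}" "p \<noteq> q" "p \<in> X" "q \<in> X"
        by (auto simp: pairs_def card_2_iff)
      obtain C where C: "C \<in> A" "p \<in> C" "q \<in> C" using cover[OF P(3,4,2)] by blast
      show "P \<in> ?Q"
      proof (cases "C = B \<and> P = {x, y}")
        case True
        then have "P \<in> pairs B'" using xy by (simp add: pair_mem_pairs)
        then show ?thesis using B ne by blast
      next
        case False
        then show ?thesis using C P pair_mem_pairs[of p C q] by auto
      qed
    qed
    moreover have "finite ?Q" using finA finB B by (auto intro: finite_pairs)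
    ultimately have "card (pairs X) \<le> card ?Q" by (rule card_mono[rotated])
    also have "\<dots> \<le> card (\<Union>C\<in>A - {B}. pairs C) + card (pairs B - {{x, y}})" by (rule card_Un_le)
    also have "\<dots> \<le> (\<Sum>C\<in>A - {B}. card (pairs C)) + 2"
    proof (rule add_mono)
      show "card (\<Union>C\<in>A - {B}. pairs C) \<le> (\<Sum>C\<in>A - {B}. card (pairs C))"
        using finA by (intro card_UN_le) simp
      have "card (pairs B - {{x, y}}) = card (pairs B) - 1"
        using xy finB[OF B(1)] by (simp add: pair_mem_pairs finite_pairs)
      then show "card (pairs B - {{x, y}}) \<le> 2" using card_pairs_block[of B] blocks[OF B(1)] by simp
    qed
    also have "(\<Sum>C\<in>A - {B}. card (pairs C)) = (\<Sum>C\<in>A - {B}. 3)"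
      by (rule sum.cong) (use blocks in \<open>auto intro: card_pairs_block\<close>)
    also have "\<dots> + 2 = 3 * (card A - 1) + 2" using finA B by simp
    also have "\<dots> < 3 * card A"
      using B finA card_gt_0_iff[of A] by (auto simp: diff_mult_distrib2)
    finally have "card (pairs X) < 3 * card A" .
    moreover have "2 * card (pairs X) = v * (v - 1)"
      using fin v twice_card_pairs by metis
    ultimately show False using few by linarith
  qed
  then have "\<exists>!B. B \<in> A \<and> x \<in> B \<and> y \<in> B" if "x \<in> X" "y \<in> X" "x \<noteq> y" for x y
    using cover[OF that] that(3) by metis
  then show ?thesis unfolding steiner_iff using fin v blocks by simp
qed

lemma steiner_card_le:
  assumes S: "steiner_triple_system v X A"
  shows "finite A" "card A \<le> v * v"
proof -
  have fin: "finite X" "card X = v" and blocks: "\<And>B. B \<in> A \<Longrightarrow> B \<subseteq> X \<and> card B = 3"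
    using S by (auto simp: steiner_iff)
  show finA: "finite A" by (rule finite_subset[of _ "Pow X"]) (use blocks fin in auto)
  have "card (\<Union>B\<in>A. pairs B) = (\<Sum>B\<in>A. card (pairs B))"
  proof (rule card_UN_disjoint)
    show "\<forall>i\<in>A. \<forall>j\<in>A. i \<noteq> j \<longrightarrow> pairs i \<inter> pairs j = {}"
    proof (intro ballI impI)
      fix B B' assume B: "B \<in> A" "B' \<in> A" "B \<noteq> B'"
      have False if P: "P \<in> pairs B" "P \<in> pairs B'" for P
      proof -
        obtain x y where "P = {x, y}" "x \<noteq> y" using P by (auto simp: pairs_def card_2_iff)
        then show False using P B steiner_block_unique[OF S B(1,2), of x y] by (auto simp: pairs_def)
      qed
      then show "pairs B \<inter> pairs B' = {}" by blast
    qed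
    show "\<forall>i\<in>A. finite (pairs i)" using blocks fin finite_subset finite_pairs by blast
  qed (rule finA)
  also have "\<dots> = (\<Sum>B\<in>A. 3)" by (rule sum.cong) (use blocks in \<open>auto intro: card_pairs_block\<close>)
  finally have "3 * card A = card (\<Union>B\<in>A. pairs B)" by simp
  also have "\<dots> \<le> card (pairs X)"
    by (rule card_mono) (use fin blocks in \<open>auto simp: pairs_def intro: finite_pairs[unfolded pairs_def]\<close>)
  also have "2 * card (pairs X) = v * (v - 1)" using fin twice_card_pairs by metis
  then have "card (pairs X) \<le> v * (v - 1)" by linarith
  also have "\<dots> \<le> v * v" by simp
  finally show "card A \<le> v * v" by simp
qed

lemma steiner_relabel:
  assumes S: "steiner_triple_system v X A" and f: "inj_on f X"
  shows "steiner_triple_system v (f ` X) ((`) f ` A)"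
proof -
  have blocks: "\<And>B. B \<in> A \<Longrightarrow> B \<subseteq> X \<and> card B = 3" using S by (auto simp: steiner_iff)
  have mem: "f x \<in> f ` B \<longleftrightarrow> x \<in> B" if "x \<in> X" "B \<in> A" for x B
    using inj_on_image_mem_iff[OF f that(1)] blocks that by blast
  have uniq: "\<exists>!B. B \<in> (`) f ` A \<and> f x \<in> B \<and> f y \<in> B" if xy: "x \<in> X" "y \<in> X" "f x \<noteq> f y" for x y
  proof -
    have ne: "x \<noteq> y" using xy by auto
    have "\<exists>!B. B \<in> A \<and> x \<in> B \<and> y \<in> B" using S xy(1,2) ne by (simp add: steiner_iff)
    then obtain B where B: "B \<in> A" "x \<in> B" "y \<in> B" by blast
    show ?thesis
    proof (rule ex1I[of _ "f ` B"])
      fix B' assume B': "B' \<in> (`) f ` A \<and> f x \<in> B' \<and> f y \<in> B'"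
      then obtain C where C: "B' = f ` C" "C \<in> A" by blast
      then have "x \<in> C" "y \<in> C" using B' mem xy by auto
      then show "B' = f ` B" using steiner_block_unique[OF S C(2) B(1)] B ne C(1) by blast
    qed (use B in blast)
  qed
  have "card (f ` B) = 3" if "B \<in> A" for B
    using blocks[OF that] card_image inj_on_subset[OF f] by metis
  moreover have "f ` B \<subseteq> f ` X" if "B \<in> A" for B using blocks[OF that] by blast
  ultimately show ?thesis unfolding steiner_iff
    using S uniq card_image[OF f] by (auto simp: steiner_iff)
qed

lemma Phi_mem_Int_Phi:
  assumes S: "steiner_triple_system v X A" "steiner_triple_system v X A'"
  shows "Phi (A \<inter> A') \<in> Int_Phi v"
proof -
  have fin: "finite X" and sub: "A \<subseteq> Pow X" "A' \<subseteq> Pow X"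
    using S by (auto simp: steiner_iff)
  obtain f :: "'a \<Rightarrow> nat" where f: "inj_on f X" using finite_imp_inj_to_nat_seg[OF fin] by blast
  have injp: "inj_on ((`) f) (Pow X)" using f by (rule inj_on_image_Pow)
  have eq: "(`) f ` A \<inter> (`) f ` A' = (`) f ` (A \<inter> A')"
    using inj_on_image_Int[OF injp sub] by simp
  have "card ((`) f ` (A \<inter> A')) = card (A \<inter> A')"
    by (rule card_image, rule inj_on_subset[OF injp]) (use sub in auto)
  moreover have "card (supp ((`) f ` (A \<inter> A'))) = card (supp (A \<inter> A'))"
  proof -
    have "supp ((`) f ` (A \<inter> A')) = f ` supp (A \<inter> A')" by (auto simp: supp_def)
    moreover have "supp (A \<inter> A') \<subseteq> X" using sub by (auto simp: supp_def)
    ultimately show ?thesis using card_image inj_on_subset[OF f] by metis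
  qed
  ultimately have "Phi ((`) f ` A \<inter> (`) f ` A') = Phi (A \<inter> A')" by (simp add: eq Phi_def)
  then show ?thesis unfolding Int_Phi_def
    using steiner_relabel[OF S(1) f] steiner_relabel[OF S(2) f] by (auto simp: Phi_def)
qed

lemma Int_Phi_bound: "finite (Int_Phi v)" "card (Int_Phi v) \<le> (v + 1) * (v * v + 1)"
proof -
  have sub: "Int_Phi v \<subseteq> {..v} \<times> {..v * v}"
  proof
    fix p assume "p \<in> Int_Phi v"
    then have "\<exists>(X :: nat set) A A'. steiner_triple_system v X A \<and> Phi (A \<inter> A') = p"
      unfolding Int_Phi_def by blast
    then obtain X :: "nat set" and A A' where S: "steiner_triple_system v X A" and p: "p = Phi (A \<inter> A')"
      by blast
    have "card (supp (A \<inter> A')) \<le> card X"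
      by (rule card_mono) (use S in \<open>auto simp: steiner_iff supp_def\<close>)
    moreover have "card (A \<inter> A') \<le> card A"
      by (rule card_mono) (use steiner_card_le[OF S] in auto)
    ultimately show "p \<in> {..v} \<times> {..v * v}"
      using p S steiner_card_le[OF S] by (auto simp: Phi_def steiner_iff)
  qed
  show "finite (Int_Phi v)" using sub by (rule finite_subset) simp
  have "card (Int_Phi v) \<le> card ({..v} \<times> {..v * v})" using sub by (rule card_mono[rotated]) simp
  then show "card (Int_Phi v) \<le> (v + 1) * (v * v + 1)" by (simp add: card_cartesian_product)
qed

text \<open>In the application \<open>s\<close> and \<open>n\<close> are cardinalities of increasing sets, so distinctness of
the pairs only needs strict monotonicity in either index.\<close>

lemma card_ge_two_chains:
  fixes s :: "nat \<Rightarrow> nat" and n :: "nat \<Rightarrow> nat \<Rightarrow> nat"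
  assumes fin: "finite S" and mem: "\<And>k m. k < K \<Longrightarrow> m < M \<Longrightarrow> (s k, n k m) \<in> S"
    and s: "\<And>k k'. k < k' \<Longrightarrow> k' < K \<Longrightarrow> s k < s k'"
    and n: "\<And>k m m'. k < K \<Longrightarrow> m < m' \<Longrightarrow> m' < M \<Longrightarrow> n k m < n k m'"
  shows "K * M \<le> card S"
proof -
  have "inj_on (\<lambda>(k, m). (s k, n k m)) ({..<K} \<times> {..<M})"
  proof (rule inj_onI)
    fix p p' assume P: "p \<in> {..<K} \<times> {..<M}" "p' \<in> {..<K} \<times> {..<M}"
      "(case p of (k, m) \<Rightarrow> (s k, n k m)) = (case p' of (k, m) \<Rightarrow> (s k, n k m))"
    obtain k m k' m' where p: "p = (k, m)" "p' = (k', m')" by (cases p, cases p') 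
    have A: "k < K" "m < M" "k' < K" "m' < M" "s k = s k'" "n k m = n k' m'" using P p by auto
    have k: "k = k'" using s[of k k'] s[of k' k] A by (cases k k' rule: linorder_cases) auto
    have "m = m'" using A n[of k m m'] n[of k m' m] k by (cases m m' rule: linorder_cases) auto
    then show "p = p'" using p k by simp
  qed
  then have "card ((\<lambda>(k, m). (s k, n k m)) ` ({..<K} \<times> {..<M})) = K * M"
    by (simp add: card_image card_cartesian_product)
  moreover have "(\<lambda>(k, m). (s k, n k m)) ` ({..<K} \<times> {..<M}) \<subseteq> S" using mem by auto
  ultimately show ?thesis using card_mono[OF fin] by metis
qed


section \<open>Triple systems from sums with free twists\<close>

datatype point = Pt nat nat bool | Infp nat

primrec level_point :: "nat \<Rightarrow> nat \<times> bool \<Rightarrow> point" where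
  "level_point l (q, r) = Pt l q r"

text \<open>A component of the leftover graph is described by numbers: 0, 1, 2 are the points at
infinity, and \<open>local_point l e a\<close> is the point with bit \<open>a\<close> on level \<open>l\<close> over the \<open>e\<close>-th index
belonging to the component.\<close>

definition local_point :: "nat \<Rightarrow> nat \<Rightarrow> bool \<Rightarrow> nat" where
  "local_point l e a = 3 + 3 * (2 * e + of_bool a) + l"

definition together :: "nat list list \<Rightarrow> nat \<Rightarrow> nat \<Rightarrow> bool" where
  "together D x y \<longleftrightarrow> (\<exists>b\<in>set D. x \<in> set b \<and> y \<in> set b)"

text \<open>A triangle decomposition of one component with \<open>E\<close> indices. Its edges join a point at
infinity to every other point, the two points over one index on a level, and each point to the
two points \<open>g c\<close> of the next level, which are the only ones that its sums with points over
other indices do not reach. These are \<open>3 * (2 * w + 5) * E\<close> edges, so the prescribed number of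
triangles makes a cover exact. The conditions are phrased with lists to be executable.\<close>

definition leftover_decomposition ::
    "nat \<Rightarrow> nat \<Rightarrow> (bool \<Rightarrow> nat \<times> bool) \<Rightarrow> nat list list \<Rightarrow> bool" where
  "leftover_decomposition w E g D \<longleftrightarrow>
     length D = (2 * w + 5) * E \<and>
     (\<forall>b\<in>set D. distinct b \<and> length b = 3 \<and> (\<exists>n\<in>set b. 3 \<le> n) \<and>
        (\<forall>n\<in>set b. n < w \<or> 3 \<le> n \<and> n < 3 + 6 * E)) \<and>
     (\<forall>l\<in>set [0..<3]. \<forall>e\<in>set [0..<E]. \<forall>a\<in>set [False, True].
        (\<forall>z\<in>set [0..<w]. together D z (local_point l e a)) \<and>
        together D (local_point l e a) (local_point l e (\<not> a)) \<and>
        (\<forall>c\<in>set [False, True].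
           together D (local_point l e a) (local_point (Suc l mod 3) (fst (g c)) (snd (g c)))))"

text \<open>The point of the next level that completes two points with index sum \<open>u\<close> and twisted bit
sum \<open>c\<close> is \<open>T u c\<close>. The components are indexed by the \<open>c < C\<close>, component \<open>c\<close> containing the \<open>E\<close>
indices congruent to \<open>c\<close> modulo \<open>C\<close>. Pairs over a single index \<open>i\<close> never enter a sum, so the
values at \<open>u = 2 * i\<close> are the ones missed by that index; \<open>T_double\<close> requires them to lie in the
component of \<open>i\<close>, at a position \<open>g c\<close> that is the same for all \<open>i\<close>.\<close>

locale sum_construction =
  fixes C E w :: nat and T :: "nat \<Rightarrow> bool \<Rightarrow> nat \<times> bool" and g :: "bool \<Rightarrow> nat \<times> bool"
    and t :: nat
  defines "t \<equiv> C * E"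
  assumes C_pos: "0 < C" and E_pos: "0 < E" and t_ge: "2 \<le> t" and w: "w = 1 \<or> w = 3"
    and T_range: "\<And>u c. u < t \<Longrightarrow> fst (T u c) < t"
    and T_surj: "\<And>q r. q < t \<Longrightarrow> \<exists>u<t. \<exists>c. T u c = (q, r)"
    and T_flip: "\<And>u. u < t \<Longrightarrow> T u True \<noteq> T u False"
    and g_range: "\<And>c. fst (g c) < E"
    and T_double: "\<And>i c. i < t \<Longrightarrow>
      T (2 * i mod t) c = (i mod C + C * fst (g c), snd (g c))"
begin

definition points :: "point set" where
  "points = (\<lambda>(l, i, a). Pt l i a) ` ({..<3} \<times> {..<t} \<times> UNIV) \<union> Infp ` {..<w}"

definition triple :: "(nat \<Rightarrow> nat set \<Rightarrow> bool) \<Rightarrow> nat \<Rightarrow> nat \<Rightarrow> nat \<Rightarrow> bool \<Rightarrow> bool \<Rightarrow> point set" where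
  "triple H l i j a b = {Pt l i a, Pt l j b,
     level_point (Suc l mod 3) (T ((i + j) mod t) ((a \<noteq> b) \<noteq> H l {i, j}))}"

definition triples :: "(nat \<Rightarrow> nat set \<Rightarrow> bool) \<Rightarrow> point set set" where
  "triples H = (\<lambda>(l, (j, i), a, b). triple H l i j a b) `
     ({..<3} \<times> (SIGMA j:{..<t}. {..<j}) \<times> UNIV \<times> UNIV)"

definition place :: "nat \<Rightarrow> nat \<Rightarrow> point" where
  "place c n = (if n < 3 then Infp n
     else Pt ((n - 3) mod 3) (c + C * ((n - 3) div 6)) (odd ((n - 3) div 3)))"

definition component :: "nat \<Rightarrow> nat list list \<Rightarrow> point set set" where
  "component c D = (\<lambda>b. place c ` set b) ` set D"

text \<open>The three points at infinity are joined by one block belonging to no component.\<close>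

definition base :: "point set set" where
  "base = (if w = 3 then {Infp ` {..<3}} else {})"

definition leftover :: "(nat \<Rightarrow> nat list list) \<Rightarrow> point set set" where
  "leftover F = (\<Union>c<C. component c (F c)) \<union> base"

definition system :: "(nat \<Rightarrow> nat set \<Rightarrow> bool) \<Rightarrow> (nat \<Rightarrow> nat list list) \<Rightarrow> point set set" where
  "system H F = triples H \<union> leftover F"

lemma finite_points: "finite points"
  by (simp add: points_def)

lemma Pt_mem_points [simp]: "Pt l i a \<in> points \<longleftrightarrow> l < 3 \<and> i < t"
  by (auto simp: points_def image_iff)

lemma Infp_mem_points [simp]: "Infp z \<in> points \<longleftrightarrow> z < w"
  by (auto simp: points_def)

lemma card_points: "card points = 6 * t + w"
proof -
  have "card ((\<lambda>(l, i, a). Pt l i a) ` ({..<3} \<times> {..<t} \<times> (UNIV :: bool set))) = 6 * t"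
    by (subst card_image) (auto simp: inj_on_def card_cartesian_product)
  moreover have "card (Infp ` {..<w}) = w" by (simp add: card_image inj_on_def)
  moreover have "(\<lambda>(l, i, a). Pt l i a) ` ({..<3} \<times> {..<t} \<times> (UNIV :: bool set)) \<inter> Infp ` {..<w} = {}"
    by auto
  ultimately show ?thesis unfolding points_def by (subst card_Un_disjoint) auto
qed

lemma place_local: "l < 3 \<Longrightarrow> place c (local_point l e a) = Pt l (c + C * e) a"
proof -
  assume l: "l < 3"
  define N where "N = 3 * (2 * e + of_bool a) + l"
  have "N div 3 = 2 * e + of_bool a" using l by (simp add: N_def)
  moreover have "N mod 3 = l" unfolding N_def using l by presburger
  moreover have "N div 6 = e" using l by (cases a) (auto simp: N_def)
  moreover have "local_point l e a = 3 + N" by (simp add: local_point_def N_def)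
  ultimately show ?thesis by (simp add: place_def)
qed

lemma place_Infp: "z < 3 \<Longrightarrow> place c z = Infp z"
  by (simp add: place_def)

lemma inj_place: "inj (place c)"
proof (rule injI)
  fix m n assume eq: "place c m = place c n"
  show "m = n"
  proof (cases "m < 3 \<or> n < 3")
    case True
    then show ?thesis using eq by (auto simp: place_def split: if_splits)
  next
    case False
    define m' n' where "m' = m - 3" and "n' = n - 3"
    have A: "m' mod 3 = n' mod 3" "m' div 6 = n' div 6" "odd (m' div 3) = odd (n' div 3)"
      using eq False C_pos by (auto simp: place_def m'_def n'_def)
    have half: "x = y" if "x div 2 = y div 2" "odd x = odd y" for x y :: nat
      using that by presburger
    have "m' div 3 = n' div 3"
      by (rule half) (use A(2,3) in \<open>simp_all add: div_mult2_eq[symmetric]\<close>)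
    then have "3 * (m' div 3) + m' mod 3 = 3 * (n' div 3) + n' mod 3" using A(1) by (simp only:)
    then have "m' = n'" unfolding mult_div_mod_eq .
    then show ?thesis using False unfolding m'_def n'_def by linarith
  qed
qed

lemma place_range:
  assumes "c < C" "n < w \<or> 3 \<le> n \<and> n < 3 + 6 * E"
  shows "place c n \<in> points"
proof (cases "n < 3")
  case True
  then show ?thesis using assms by (simp add: place_def)
next
  case False
  then have "3 \<le> n" "n < 3 + 6 * E" using assms w by auto
  then have "(n - 3) div 6 < E" by (simp add: less_mult_imp_div_less mult.commute)
  then have "C * Suc ((n - 3) div 6) \<le> C * E" by (intro mult_le_mono2) simp
  then have "c + C * ((n - 3) div 6) < t" using assms(1) by (simp add: t_def)
  then show ?thesis using False by (simp add: place_def)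
qed

lemma Pt_mem_component:
  assumes "Pt l i a \<in> B" "B \<in> component c D" "c < C"
  shows "i mod C = c"
  using assms by (auto simp: component_def place_def split: if_splits)

lemma component_has_Pt:
  assumes "leftover_decomposition w E g D" "B \<in> component c D"
  shows "\<exists>l i a. Pt l i a \<in> B"
proof -
  obtain b n where "B = place c ` set b" "n \<in> set b" "3 \<le> n"
    using assms unfolding component_def leftover_decomposition_def by blast
  then have "place c n \<in> B" "\<not> n < 3" by auto
  then show ?thesis unfolding place_def by (simp only: if_False) blast
qed

text \<open>A component is determined by the index of any of its points outside infinity, and each of
its blocks has such a point.\<close>

lemma component_disjoint:
  assumes "leftover_decomposition w E g D" "B \<in> component c D" "B \<in> component c' D'" "c < C" "c' < C"
  shows "c = c'"
proof -
  obtain l i a where "Pt l i a \<in> B" using component_has_Pt[OF assms(1,2)] by blast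
  then show ?thesis
    using Pt_mem_component[OF _ assms(2,4)] Pt_mem_component[OF _ assms(3,5)] by simp
qed

lemma level_point_T: "u < t \<Longrightarrow> \<exists>q r. T u c = (q, r) \<and> q < t"
  using T_range[of u c] by (cases "T u c") auto

lemma t_pos: "0 < t" using t_ge by simp

lemma Suc_mod3: "l < 3 \<Longrightarrow> Suc l mod 3 \<noteq> l"
  by (auto simp: mod_Suc)

lemma levels_cyclic: "l < 3 \<Longrightarrow> l' < 3 \<Longrightarrow> l' = l \<or> l' = Suc l mod 3 \<or> l = Suc l' mod 3"
proof -
  assume "l < 3" "l' < 3"
  then have "l = 0 \<or> l = 1 \<or> l = 2" "l' = 0 \<or> l' = 1 \<or> l' = 2" by linarith+
  then show ?thesis by (elim disjE) simp_all
qed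

lemma triple_block:
  assumes "l < 3" "i < t" "j < t" "i \<noteq> j"
  shows "triple H l i j a b \<subseteq> points \<and> card (triple H l i j a b) = 3"
proof -
  obtain q r where q: "T ((i + j) mod t) ((a \<noteq> b) \<noteq> H l {i, j}) = (q, r)" "q < t"
    using level_point_T t_pos by (metis mod_less_divisor)
  show ?thesis unfolding triple_def q(1) using assms q(2) Suc_mod3[of l] by auto
qed

lemma triple_commute: "triple H l i j a b = triple H l j i b a"
proof -
  have "(a \<noteq> b) = (b \<noteq> a)" by blast
  then show ?thesis by (simp only: triple_def add.commute insert_commute)
qed

lemma triple_mem: "l < 3 \<Longrightarrow> i < t \<Longrightarrow> j < t \<Longrightarrow> i \<noteq> j \<Longrightarrow> triple H l i j a b \<in> triples H"
proof (induction i j arbitrary: a b rule: linorder_wlog)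
  case (le i j)
  then show ?case unfolding triples_def by (intro image_eqI[of _ _ "(l, (j, i), a, b)"]) auto
next
  case (sym i j)
  then show ?case by (metis triple_commute)
qed

lemma triplesE:
  assumes "B \<in> triples H"
  obtains l i j a b where "B = triple H l i j a b" "l < 3" "i < j" "j < t"
  using assms unfolding triples_def by auto

lemma component_block:
  assumes "leftover_decomposition w E g D" "B \<in> component c D" "c < C"
  shows "B \<subseteq> points \<and> card B = 3"
proof -
  obtain b where b: "b \<in> set D" "B = place c ` set b" using assms(2) by (auto simp: component_def)
  have "distinct b" "length b = 3" "\<forall>n\<in>set b. n < w \<or> 3 \<le> n \<and> n < 3 + 6 * E"
    using assms(1) b(1) by (auto simp: leftover_decomposition_def)
  then have "place c ` set b \<subseteq> points" "card (set b) = 3"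
    using place_range[OF assms(3)] distinct_card[of b] by auto
  moreover have "card (place c ` set b) = card (set b)"
    by (rule card_image, rule inj_on_subset[OF inj_place]) simp
  ultimately show ?thesis by (simp add: b(2))
qed

lemma base_block: "B \<in> base \<Longrightarrow> B \<subseteq> points \<and> card B = 3"
proof -
  assume "B \<in> base"
  then have B: "B = Infp ` {..<w}" "w = 3" by (simp_all add: base_def split: if_splits)
  have "card (Infp ` {..<w}) = card {..<w}" by (rule card_image) (simp add: inj_on_def)
  moreover have "Infp ` {..<w} \<subseteq> points" unfolding points_def by (rule Un_upper2)
  ultimately show ?thesis unfolding B(1) using B(2) by simp
qed

lemma component_together:
  assumes "together D m n" shows "\<exists>B\<in>component c D. place c m \<in> B \<and> place c n \<in> B"
  using assms unfolding together_def component_def by blast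

lemma card_triples_le: "card (triples H) \<le> 6 * (t * (t - 1))"
proof -
  define I where "I = (SIGMA j:{..<t}. {..<j})"
  have "card I = (\<Sum>j<t. j)" by (simp add: I_def)
  moreover have "2 * (\<Sum>j<n. j) = n * (n - 1)" for n :: nat
    by (induction n) (auto simp: algebra_simps)
  ultimately have I: "2 * card I = t * (t - 1)" by simp
  have "card (triples H) \<le> card ({..<3::nat} \<times> I \<times> (UNIV :: bool set) \<times> (UNIV :: bool set))"
    unfolding triples_def I_def by (rule card_image_le) auto
  also have "\<dots> = 6 * (2 * card I)"
    unfolding card_cartesian_product card_UNIV_bool card_lessThan by simp
  finally show ?thesis unfolding I .
qed

lemma card_leftover_le:
  assumes "\<And>c. leftover_decomposition w E g (F c)"
  shows "card (leftover F) \<le> (2 * w + 5) * t + of_bool (w = 3)"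
proof -
  have "card (component c (F c)) \<le> (2 * w + 5) * E" for c
  proof -
    have "card (component c (F c)) \<le> card (set (F c))" unfolding component_def by (rule card_image_le) simp
    also have "\<dots> \<le> length (F c)" by (rule card_length)
    finally show ?thesis using assms[of c] by (simp add: leftover_decomposition_def)
  qed
  then have "(\<Sum>c<C. card (component c (F c))) \<le> (\<Sum>c<C. (2 * w + 5) * E)" by (intro sum_mono)
  then have "card (\<Union>c<C. component c (F c)) \<le> (2 * w + 5) * t"
    using card_UN_le[of "{..<C}" "\<lambda>c. component c (F c)"] by (simp add: t_def mult.left_commute mult.commute)
  moreover have "card base \<le> of_bool (w = 3)" by (simp add: base_def)
  ultimately show ?thesis unfolding leftover_def
    using card_Un_le[of "\<Union>c<C. component c (F c)" base] by linarith
qed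


definition joined :: "(nat \<Rightarrow> nat set \<Rightarrow> bool) \<Rightarrow> (nat \<Rightarrow> nat list list) \<Rightarrow> point \<Rightarrow> point \<Rightarrow> bool" where
  "joined H F x y \<longleftrightarrow> (\<exists>B\<in>system H F. x \<in> B \<and> y \<in> B)"

lemma joined_commute: "joined H F x y \<Longrightarrow> joined H F y x"
  unfolding joined_def by blast

lemma joined_place:
  assumes "together (F c) m n" "c < C"
  shows "joined H F (place c m) (place c n)"
  using component_together[OF assms(1), of c] assms(2)
  unfolding joined_def system_def leftover_def by blast

lemma local_coordinates:
  assumes "l < 3" "i < t"
  shows "place (i mod C) (local_point l (i div C) a) = Pt l i a" "i div C < E" "i mod C < C"
proof -
  show "place (i mod C) (local_point l (i div C) a) = Pt l i a"
    using assms(1) by (simp add: place_local)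
  show "i div C < E" using assms(2) by (simp add: t_def less_mult_imp_div_less mult.commute)
  show "i mod C < C" using C_pos by simp
qed

lemma decomposition_together:
  assumes "leftover_decomposition w E g D" "l < 3" "e < E"
  shows "z < w \<Longrightarrow> together D z (local_point l e a)"
    and "together D (local_point l e a) (local_point l e (\<not> a))"
    and "together D (local_point l e a) (local_point (Suc l mod 3) (fst (g c)) (snd (g c)))"
proof -
  have "\<forall>l\<in>set [0..<3]. \<forall>e\<in>set [0..<E]. \<forall>a\<in>set [False, True].
        (\<forall>z\<in>set [0..<w]. together D z (local_point l e a)) \<and>
        together D (local_point l e a) (local_point l e (\<not> a)) \<and>
        (\<forall>c\<in>set [False, True].
           together D (local_point l e a) (local_point (Suc l mod 3) (fst (g c)) (snd (g c))))"
    using assms(1) unfolding leftover_decomposition_def by (elim conjE)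
  moreover have "l \<in> set [0..<3]" "e \<in> set [0..<E]" "a \<in> set [False, True]" "c \<in> set [False, True]"
    using assms(2,3) by auto
  ultimately have A: "(\<forall>z\<in>set [0..<w]. together D z (local_point l e a)) \<and>
        together D (local_point l e a) (local_point l e (\<not> a)) \<and>
        (\<forall>c\<in>set [False, True].
           together D (local_point l e a) (local_point (Suc l mod 3) (fst (g c)) (snd (g c))))"
    by blast
  then show "together D (local_point l e a) (local_point l e (\<not> a))" by (elim conjE)
  show "z < w \<Longrightarrow> together D z (local_point l e a)" using A by simp
  show "together D (local_point l e a) (local_point (Suc l mod 3) (fst (g c)) (snd (g c)))"
    using A \<open>c \<in> set [False, True]\<close> by blast
qed

text \<open>Given \<open>Pt l i a\<close> and the target \<open>T u c\<close>, the partner index must be \<open>j = u - i\<close>, and the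
bit of the partner can absorb any twist. The only failure \<open>j = i\<close> is an edge of the leftover
graph.\<close>

lemma joined_next_level:
  assumes dec: "\<And>c. leftover_decomposition w E g (F c)" and lt: "l < 3" "i < t" "q < t"
  shows "joined H F (Pt l i a) (Pt (Suc l mod 3) q r)"
proof -
  obtain u c where u: "u < t" "T u c = (q, r)" using T_surj[OF lt(3)] by blast
  define j where "j = (u + (t - i)) mod t"
  have j: "j < t" using t_pos by (simp add: j_def)
  have ij: "(i + j) mod t = u"
  proof -
    have "(i + j) mod t = (i + (u + (t - i))) mod t" unfolding j_def by (simp add: mod_simps)
    also have "i + (u + (t - i)) = u + t" using lt by simp
    finally show ?thesis using u by simp
  qed
  show ?thesis
  proof (cases "j = i")
    case True
    then have "2 * i mod t = u" using ij by (simp add: mult_2)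
    then have qr: "q = i mod C + C * fst (g c)" "r = snd (g c)" using T_double[OF lt(2), of c] u(2) by auto
    have "joined H F (place (i mod C) (local_point l (i div C) a))
        (place (i mod C) (local_point (Suc l mod 3) (fst (g c)) (snd (g c))))"
      by (rule joined_place) (use decomposition_together(3)[OF dec lt(1)] local_coordinates[OF lt(1,2)] in auto)
    then show ?thesis using local_coordinates[OF lt(1,2)] by (simp add: place_local qr)
  next
    case False
    define b where "b = (a \<noteq> (c \<noteq> H l {i, j}))"
    have "((a \<noteq> b) \<noteq> H l {i, j}) = c" unfolding b_def by blast
    then have "Pt (Suc l mod 3) q r \<in> triple H l i j a b"
      unfolding triple_def ij by (simp add: u(2))
    moreover have "Pt l i a \<in> triple H l i j a b" by (simp add: triple_def)
    moreover have "triple H l i j a b \<in> system H F"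
      using triple_mem[OF lt(1,2) j] False by (auto simp: system_def)
    ultimately show ?thesis unfolding joined_def by blast
  qed
qed

lemma joined_same_level:
  assumes dec: "\<And>c. leftover_decomposition w E g (F c)" and lt: "l < 3" "i < t" "j < t"
    and ne: "(i, a) \<noteq> (j, b)"
  shows "joined H F (Pt l i a) (Pt l j b)"
proof (cases "i = j")
  case True
  then have b: "b = (\<not> a)" using ne by blast
  have "joined H F (place (i mod C) (local_point l (i div C) a))
        (place (i mod C) (local_point l (i div C) (\<not> a)))"
    by (rule joined_place) (use decomposition_together(2)[OF dec lt(1)] local_coordinates[OF lt(1,2)] in auto)
  then show ?thesis using local_coordinates[OF lt(1,2)] True b by simp
next
  case False
  then have "triple H l i j a b \<in> system H F" using triple_mem[OF lt] by (simp add: system_def)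
  then show ?thesis unfolding joined_def by (rule bexI[rotated]) (simp add: triple_def)
qed

lemma joined_Infp_Pt:
  assumes dec: "\<And>c. leftover_decomposition w E g (F c)" and lt: "z < w" "l < 3" "i < t"
  shows "joined H F (Infp z) (Pt l i a)"
proof -
  have "joined H F (place (i mod C) z) (place (i mod C) (local_point l (i div C) a))"
    by (rule joined_place) (use decomposition_together(1)[OF dec lt(2)] lt(1) local_coordinates[OF lt(2,3)] in auto)
  moreover have "place (i mod C) z = Infp z" using lt(1) w by (intro place_Infp) auto
  ultimately show ?thesis using local_coordinates[OF lt(2,3)] by simp
qed

lemma joined_Infp:
  assumes "z < w" "z' < w" "z \<noteq> z'"
  shows "joined H F (Infp z) (Infp z')"
proof -
  have "w = 3" using assms w by auto
  then have "Infp ` {..<3} \<in> system H F" unfolding system_def leftover_def base_def by auto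
  then show ?thesis unfolding joined_def
    by (rule bexI[rotated]) (use assms \<open>w = 3\<close> in auto)
qed

lemma system_joined:
  assumes dec: "\<And>c. leftover_decomposition w E g (F c)"
    and x: "x \<in> points" and y: "y \<in> points" and ne: "x \<noteq> y"
  shows "joined H F x y"
proof (cases x)
  case (Infp z)
  note xz = Infp
  show ?thesis
  proof (cases y)
    case (Pt l i a)
    show ?thesis unfolding xz Pt by (rule joined_Infp_Pt[OF dec]) (use x y xz Pt in simp_all)
  next
    case (Infp z')
    show ?thesis unfolding xz Infp by (rule joined_Infp) (use x y xz Infp ne in simp_all)
  qed
next
  case (Pt l i a)
  note xl = Pt
  show ?thesis
  proof (cases y)
    case (Infp z)
    show ?thesis unfolding xl Infp
      by (rule joined_commute[OF joined_Infp_Pt[OF dec]]) (use x y xl Infp in simp_all)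
  next
    case (Pt l' j b)
    have lt: "l < 3" "l' < 3" "i < t" "j < t" using x y xl Pt by auto
    have "l' = l \<or> l' = Suc l mod 3 \<or> l = Suc l' mod 3" using levels_cyclic[OF lt(1,2)] .
    then show ?thesis
    proof (elim disjE)
      assume l: "l' = l"
      have ij: "(i, a) \<noteq> (j, b)" using ne unfolding xl Pt l by blast
      show ?thesis unfolding xl Pt l by (rule joined_same_level[OF dec lt(1,3,4) ij])
    next
      assume l: "l' = Suc l mod 3"
      show ?thesis unfolding xl Pt l by (rule joined_next_level[OF dec lt(1,3,4)])
    next
      assume l: "l = Suc l' mod 3"
      show ?thesis unfolding xl Pt l by (rule joined_commute[OF joined_next_level[OF dec lt(2,4,3)]])
    qed
  qed
qed

theorem steiner_system:
  assumes dec: "\<And>c. leftover_decomposition w E g (F c)"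
  shows "steiner_triple_system (6 * t + w) points (system H F)"
proof (rule steiner_by_counting)
  show "finite points" by (rule finite_points)
  show "card points = 6 * t + w" by (rule card_points)
  show "\<exists>B\<in>system H F. x \<in> B \<and> y \<in> B" if "x \<in> points" "y \<in> points" "x \<noteq> y" for x y
    using system_joined[OF dec that] by (simp add: joined_def)
  show "B \<subseteq> points \<and> card B = 3" if B: "B \<in> system H F" for B
  proof -
    consider "B \<in> triples H" | c where "c < C" "B \<in> component c (F c)" | "B \<in> base"
      using B by (auto simp: system_def leftover_def)
    then show ?thesis
    proof cases
      case 1
      then show ?thesis by (elim triplesE) (simp add: triple_block)
    next
      case 2
      then show ?thesis using component_block[OF dec] by blast
    qed (rule base_block)
  qed
  have "card (system H F) \<le> 6 * (t * (t - 1)) + ((2 * w + 5) * t + of_bool (w = 3))"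
    unfolding system_def
    using card_triples_le[of H] card_leftover_le[of F, OF dec] card_Un_le[of "triples H" "leftover F"]
    by linarith
  then have "6 * card (system H F) \<le> 6 * (6 * (t * (t - 1)) + ((2 * w + 5) * t + of_bool (w = 3)))"
    by (rule mult_le_mono2)
  also have "\<dots> = (6 * t + w) * (6 * t + w - 1)"
  proof -
    obtain n where n: "t = Suc n" using t_pos gr0_implies_Suc by blast
    show ?thesis using w unfolding n by (elim disjE) (simp_all add: algebra_simps)
  qed
  finally show "6 * card (system H F) \<le> (6 * t + w) * (6 * t + w - 1)" .
qed


text \<open>Both systems contain exactly one block through two points of a level, and its third point
reveals the twist.\<close>

lemma triple_mem_other_twist:
  assumes dec: "\<And>c. leftover_decomposition w E g (F c)"
    and lt: "l < 3" "i < t" "j < t" "i \<noteq> j"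
    and mem: "triple H l i j a b \<in> system H' F"
  shows "H l {i, j} = H' l {i, j}"
proof -
  define u where "u = (i + j) mod t"
  have u: "u < t" using t_pos by (simp add: u_def)
  have "triple H' l i j a b \<in> system H' F" using triple_mem[OF lt] by (simp add: system_def)
  then have eq: "triple H l i j a b = triple H' l i j a b"
    by (rule steiner_block_unique[OF steiner_system[of F, OF dec] mem, of _ "Pt l i a" "Pt l j b"])
      (use lt in \<open>simp_all add: triple_def\<close>)
  define x y where "x = ((a \<noteq> b) \<noteq> H l {i, j})" and "y = ((a \<noteq> b) \<noteq> H' l {i, j})"
  have tr: "triple H l i j a b = {Pt l i a, Pt l j b, level_point (Suc l mod 3) (T u x)}"
    "triple H' l i j a b = {Pt l i a, Pt l j b, level_point (Suc l mod 3) (T u y)}"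
    unfolding triple_def u_def x_def y_def by (rule refl)+
  obtain q r where q: "T u x = (q, r)" using level_point_T u by blast
  obtain q' r' where q': "T u y = (q', r')" using level_point_T u by blast
  have "level_point (Suc l mod 3) (T u x) \<in> triple H l i j a b" unfolding tr by blast
  then have "Pt (Suc l mod 3) q r \<in> {Pt l i a, Pt l j b, Pt (Suc l mod 3) q' r'}"
    unfolding eq unfolding tr q q' level_point.simps .
  then have "T u x = T u y" using Suc_mod3[OF lt(1)] unfolding q q' by simp
  then have "x = y" using T_flip[OF u] by (cases x; cases y) auto
  then show ?thesis unfolding x_def y_def by blast
qed

definition plain :: "nat \<Rightarrow> nat set \<Rightarrow> bool" where
  "plain l p = False"

definition twisted_off :: "nat set set \<Rightarrow> nat \<Rightarrow> nat set \<Rightarrow> bool" where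
  "twisted_off G l p \<longleftrightarrow> \<not> (l = 0 \<and> p \<in> G)"

definition kept :: "nat set set \<Rightarrow> point set set" where
  "kept G = {triple plain 0 i j a b | i j a b. i < t \<and> j < t \<and> i \<noteq> j \<and> {i, j} \<in> G}"

lemma system_Int:
  assumes dec: "\<And>c. leftover_decomposition w E g (F c)" "\<And>c. leftover_decomposition w E g (F' c)"
  shows "system plain F \<inter> system (twisted_off G) F' = kept G \<union> (leftover F \<inter> leftover F')"
proof (intro equalityI subsetI)
  fix B assume B: "B \<in> system plain F \<inter> system (twisted_off G) F'"
  show "B \<in> kept G \<union> (leftover F \<inter> leftover F')"
  proof (cases "B \<in> leftover F \<inter> leftover F'")
    case False
    then have "B \<in> triples plain \<or> B \<in> triples (twisted_off G)" using B by (auto simp: system_def)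
    then have "B \<in> kept G"
    proof
      assume "B \<in> triples plain"
      then obtain l i j a b where t: "B = triple plain l i j a b" "l < 3" "i < j" "j < t"
        by (rule triplesE)
      have "plain l {i, j} = twisted_off G l {i, j}"
        by (rule triple_mem_other_twist[of F', OF dec(2)]) (use t B in auto)
      then have "l = 0" "{i, j} \<in> G" by (auto simp: plain_def twisted_off_def)
      then show ?thesis unfolding kept_def using t by force
    next
      assume "B \<in> triples (twisted_off G)"
      then obtain l i j a b where t: "B = triple (twisted_off G) l i j a b" "l < 3" "i < j" "j < t"
        by (rule triplesE)
      have eq: "twisted_off G l {i, j} = plain l {i, j}"
        by (rule triple_mem_other_twist[of F, OF dec(1)]) (use t B in auto)
      then have "B = triple plain l i j a b" unfolding t(1) triple_def by simp
      moreover have "l = 0" "{i, j} \<in> G" using eq by (auto simp: plain_def twisted_off_def)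
      ultimately show ?thesis unfolding kept_def using t by force
    qed
    then show ?thesis ..
  qed blast
next
  fix B assume "B \<in> kept G \<union> (leftover F \<inter> leftover F')"
  then show "B \<in> system plain F \<inter> system (twisted_off G) F'"
  proof
    assume "B \<in> kept G"
    then obtain i j a b where t: "B = triple plain 0 i j a b" "i < t" "j < t" "i \<noteq> j" "{i, j} \<in> G"
      unfolding kept_def by blast
    have "triple plain 0 i j a b = triple (twisted_off G) 0 i j a b"
      using t(5) by (simp add: triple_def plain_def twisted_off_def)
    then show ?thesis using t triple_mem[of 0 i j] unfolding system_def by (metis IntI UnI1 zero_less_numeral)
  qed (simp add: system_def)
qed

end

text \<open>The decompositions \<open>D\<close> and \<open>D'\<close> may share triangles, but none at the point
\<open>local_point 2 0 False\<close>, which is therefore covered by the common blocks only in components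
where both systems use \<open>D\<close>. Completely disjoint decompositions do not always exist: for
\<open>E = 2\<close>, \<open>w = 1\<close> there are only four decompositions, and any two of them meet.\<close>

locale paired_construction = sum_construction +
  fixes D D' :: "nat list list"
  assumes dec: "leftover_decomposition w E g D" and dec': "leftover_decomposition w E g D'"
    and differ: "\<forall>b\<in>set D. \<forall>b'\<in>set D'. local_point 2 0 False \<in> set b \<longrightarrow> set b \<noteq> set b'"
begin

definition switched :: "nat \<Rightarrow> nat \<Rightarrow> nat list list" where
  "switched k c = (if c \<le> k then D else D')"

definition shared :: "nat \<Rightarrow> point set set" where
  "shared k = leftover (\<lambda>_. D) \<inter> leftover (switched k)"

definition common :: "nat set set \<Rightarrow> nat \<Rightarrow> point set set" where
  "common G k = system plain (\<lambda>_. D) \<inter> system (twisted_off G) (switched k)"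

lemma dec_switched: "leftover_decomposition w E g (switched k c)"
  using dec dec' by (simp add: switched_def)

lemma common_eq: "common G k = kept G \<union> shared k"
  unfolding common_def shared_def by (rule system_Int) (rule dec dec_switched)+

lemma Phi_common: "Phi (common G k) \<in> Int_Phi (6 * t + w)"
  unfolding common_def by (rule Phi_mem_Int_Phi) (rule steiner_system dec dec_switched)+

lemma common_subset: "B \<in> common G k \<Longrightarrow> B \<subseteq> points"
  using steiner_system[of "\<lambda>_. D" plain, OF dec] unfolding common_def steiner_iff by blast

lemma finite_common: "finite (common G k)"
  by (rule finite_subset[of _ "Pow points"]) (use common_subset finite_points in auto)

lemma common_strict_mono:
  assumes "G \<subset> G'" and G': "G' \<subseteq> pairs {..<t}"
  shows "common G k \<subset> common G' k"
proof
  have "kept G \<subseteq> kept G'" unfolding kept_def using assms(1) by blast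
  then show "common G k \<subseteq> common G' k" unfolding common_eq by blast
  obtain p where p: "p \<in> G'" "p \<notin> G" using assms(1) by blast
  then obtain i j where ij: "p = {i, j}" "i \<noteq> j" "i < t" "j < t"
    using G' by (auto simp: pairs_def card_2_iff)
  let ?B = "triple plain 0 i j False False"
  have "?B \<in> kept G'" unfolding kept_def using p ij by blast
  then have "?B \<in> common G' k" unfolding common_eq ..
  moreover have "?B \<notin> common G k"
  proof
    assume "?B \<in> common G k"
    then have "?B \<in> system (twisted_off G) (switched k)" by (simp add: common_def)
    then have "plain 0 {i, j} = twisted_off G 0 {i, j}"
      by (intro triple_mem_other_twist[of "switched k", OF dec_switched]) (use ij in auto)
    then show False using p ij by (simp add: plain_def twisted_off_def)
  qed
  ultimately show "common G k \<noteq> common G' k" by blast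
qed

lemma component_shared:
  assumes "c < C" "c \<le> k" shows "component c D \<subseteq> shared k"
  using assms unfolding shared_def leftover_def switched_def by auto

lemma shared_mono:
  assumes "k \<le> k'" shows "shared k \<subseteq> shared k'"
proof
  fix B assume B: "B \<in> shared k"
  show "B \<in> shared k'"
  proof (cases "B \<in> base")
    case True
    then show ?thesis by (simp add: shared_def leftover_def)
  next
    case False
    then obtain c c' where c: "c < C" "B \<in> component c D" "c' < C" "B \<in> component c' (switched k c')"
      using B unfolding shared_def leftover_def by blast
    have "c = c'" using component_disjoint[OF dec c(2,4,1,3)] .
    then have "B \<in> component c (switched k' c)"
      using c assms by (cases "c \<le> k'") (auto simp: switched_def)
    then show ?thesis using c(1,2) unfolding shared_def leftover_def by blast
  qed
qed

text \<open>A block shared by the decompositions at this point would have to come from component \<open>k'\<close>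
in both systems, thus from \<open>D\<close> and \<open>D'\<close> for parameter \<open>k\<close>.\<close>

lemma shared_new_point:
  assumes k: "k < k'" "k' < C"
  shows "Pt 2 k' False \<in> supp (shared k')" "Pt 2 k' False \<notin> supp (shared k)"
proof -
  have pl: "place k' (local_point 2 0 False) = Pt 2 k' False" by (simp add: place_local)
  have "together D 0 (local_point 2 0 False)"
    by (rule decomposition_together(1)[OF dec]) (use w E_pos in auto)
  then obtain B where "B \<in> component k' D" "Pt 2 k' False \<in> B"
    using component_together[of D 0 "local_point 2 0 False" k'] pl by auto
  then show "Pt 2 k' False \<in> supp (shared k')"
    using component_shared[OF k(2) order_refl] unfolding supp_def by blast
  show "Pt 2 k' False \<notin> supp (shared k)"
  proof
    assume "Pt 2 k' False \<in> supp (shared k)"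
    then obtain B where B: "B \<in> shared k" "Pt 2 k' False \<in> B" by (auto simp: supp_def)
    have "B \<notin> base" using B(2) by (auto simp: base_def split: if_splits)
    then obtain c c' where c: "c < C" "B \<in> component c D" "c' < C" "B \<in> component c' (switched k c')"
      using B(1) unfolding shared_def leftover_def by blast
    have "c = k'" "c' = k'" using Pt_mem_component[OF B(2)] c k by auto
    then have "B \<in> component k' D" "B \<in> component k' D'" using c k by (auto simp: switched_def)
    then obtain b b' where b: "b \<in> set D" "b' \<in> set D'" "B = place k' ` set b" "B = place k' ` set b'"
      unfolding component_def by blast
    have "set b = set b'" using b(3,4) inj_image_eq_iff[OF inj_place] by metis
    moreover have "local_point 2 0 False \<in> set b"
      using B(2) inj_image_mem_iff[OF inj_place] unfolding b(3) pl[symmetric] by blast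
    ultimately show False using differ b(1,2) by blast
  qed
qed

definition star :: "nat set set" where
  "star = (\<lambda>j. {0, j}) ` {1..<t}"

text \<open>The kept blocks lie on levels 0 and 1. Those of the star cover both levels except for the
targets of the sum 0 on level 1; these belong to component 0, where the two systems always
agree.\<close>

lemma supp_common:
  assumes G: "star \<subseteq> G"
  shows "supp (common G k) = (\<lambda>(l, i, a). Pt l i a) ` ({..<2} \<times> {..<t} \<times> UNIV) \<union> supp (shared k)"
    (is "_ = ?L \<union> _")
proof -
  have kept_L: "supp (kept G) \<subseteq> ?L"
  proof
    fix x assume "x \<in> supp (kept G)"
    then obtain i j a b where ij: "x \<in> triple plain 0 i j a b" "i < t" "j < t"
      by (auto simp: supp_def kept_def)
    obtain q r where q: "T ((i + j) mod t) ((a \<noteq> b) \<noteq> plain 0 {i, j}) = (q, r)" "q < t"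
      using level_point_T t_pos by (metis mod_less_divisor)
    have "x = Pt 0 i a \<or> x = Pt 0 j b \<or> x = Pt 1 q r" using ij(1) unfolding triple_def q(1) by simp
    moreover have "Pt l i a \<in> ?L" if "l < 2" "i < t" for l i a
      by (rule image_eqI[of _ _ "(l, i, a)"]) (use that in simp_all)
    ultimately show "x \<in> ?L" using ij(2,3) q(2) by (elim disjE) simp_all
  qed
  have star_kept: "triple plain 0 0 j a b \<in> kept G" if "0 < j" "j < t" for j a b
  proof -
    have "{0, j} \<in> G" using that G by (auto simp: star_def)
    then show ?thesis unfolding kept_def using that by (intro CollectI exI[of _ "0::nat"] exI[of _ j]) auto
  qed
  have level0: "Pt 0 i a \<in> supp (common G k)" if "i < t" for i a
  proof (cases "i = 0")
    case True
    then have "Pt 0 i a \<in> triple plain 0 0 1 a False" by (simp add: triple_def)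
    moreover have "triple plain 0 0 1 a False \<in> common G k" using star_kept[of 1] t_ge by (simp add: common_eq)
    ultimately show ?thesis unfolding supp_def by blast
  next
    case False
    have "Pt 0 i a \<in> triple plain 0 0 i False a" by (simp add: triple_def)
    moreover have "triple plain 0 0 i False a \<in> common G k" using star_kept[of i] False that by (simp add: common_eq)
    ultimately show ?thesis unfolding supp_def by blast
  qed
  have level1: "Pt 1 q r \<in> supp (common G k)" if "q < t" for q r
  proof -
    obtain u c where u: "u < t" "T u c = (q, r)" using T_surj \<open>q < t\<close> by blast
    show ?thesis
    proof (cases "u = 0")
      case True
      then have qr: "q = C * fst (g c)" "r = snd (g c)" using T_double[of 0 c] t_pos u by auto
      have "place 0 (local_point 1 (fst (g c)) (snd (g c))) = Pt 1 q r" using qr by (simp add: place_local)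
      moreover have "together D 0 (local_point 1 (fst (g c)) (snd (g c)))"
        by (rule decomposition_together(1)[OF dec]) (use w g_range in auto)
      ultimately obtain B where "B \<in> component 0 D" "Pt 1 q r \<in> B"
        using component_together[of D 0 _ 0] by metis
      then show ?thesis using component_shared[of 0 k] C_pos unfolding supp_def common_eq by blast
    next
      case False
      have "Pt 1 q r \<in> triple plain 0 0 u False c" using u by (simp add: triple_def plain_def)
      moreover have "triple plain 0 0 u False c \<in> common G k" using star_kept[of u] False u by (simp add: common_eq)
      ultimately show ?thesis unfolding supp_def by blast
    qed
  qed
  have "?L \<subseteq> supp (common G k)"
  proof (rule image_subsetI)
    fix x :: "nat \<times> nat \<times> bool" assume x: "x \<in> {..<2} \<times> {..<t} \<times> UNIV"
    obtain l i a where lia: "x = (l, i, a)" by (cases x) 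
    then have "l = 0 \<or> l = 1" "i < t" using x by auto
    then show "(case x of (l, i, a) \<Rightarrow> Pt l i a) \<in> supp (common G k)" using level0 level1 lia by auto
  qed
  moreover have "supp (common G k) = supp (kept G) \<union> supp (shared k)" by (simp add: common_eq supp_def)
  ultimately show ?thesis using kept_L by blast
qed

lemma card_supp_common_less:
  assumes "star \<subseteq> G" "star \<subseteq> G'" "k < k'" "k' < C"
  shows "card (supp (common G k)) < card (supp (common G' k'))"
proof (rule psubset_card_mono)
  have "supp (common G' k') \<subseteq> points" using common_subset by (auto simp: supp_def)
  then show "finite (supp (common G' k'))" using finite_points by (rule finite_subset)
  have "supp (shared k) \<subseteq> supp (shared k')" using shared_mono[of k k'] assms(3) by (auto simp: supp_def)
  moreover have "Pt 2 k' False \<notin> (\<lambda>(l, i, a). Pt l i a) ` ({..<2} \<times> {..<t} \<times> (UNIV :: bool set))"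
    by auto
  ultimately show "supp (common G k) \<subset> supp (common G' k')"
    unfolding supp_common[OF assms(1)] supp_common[OF assms(2)]
    using shared_new_point[OF assms(3,4)] by blast
qed

theorem card_Int_Phi_ge: "C * (((t - 1) choose 2) + 1) \<le> card (Int_Phi (6 * t + w))"
proof -
  define R where "R = pairs {1..<t}"
  have R: "finite R" "card R = (t - 1) choose 2" by (simp_all add: R_def finite_pairs card_pairs)
  obtain e where e: "bij_betw e {0..<card R} R" using ex_bij_betw_nat_finite[OF R(1)] by blast
  \<comment> \<open>Only pairs avoiding 0 are varied, so that the star is always present.\<close>
  define G where "G m = star \<union> e ` {..<m}" for m
  have inR: "e m \<in> R" if "m < card R" for m using bij_betwE[OF e] that by simp
  have star: "star \<subseteq> G m" for m by (simp add: G_def)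
  have Gpairs: "G m \<subseteq> pairs {..<t}" if "m \<le> card R" for m
  proof -
    have "star \<subseteq> pairs {..<t}" by (auto simp: star_def pairs_def)
    moreover have "R \<subseteq> pairs {..<t}" by (auto simp: R_def pairs_def)
    ultimately show ?thesis using inR that by (auto simp: G_def)
  qed
  have G_less: "G m \<subset> G m'" if "m < m'" "m' \<le> card R" for m m'
  proof
    show "G m \<subseteq> G m'" using that by (auto simp: G_def)
    have "e m \<notin> star" using inR[of m] that by (auto simp: R_def star_def pairs_def)
    moreover have "e m \<notin> e ` {..<m}"
    proof
      assume "e m \<in> e ` {..<m}"
      then obtain n where n: "n < m" "e m = e n" by (elim imageE) simp
      have "m = n"
        by (rule inj_onD[OF bij_betw_imp_inj_on[OF e] n(2)]) (use n(1) that in simp_all)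
      then show False using n(1) by simp
    qed
    ultimately have "e m \<notin> G m" unfolding G_def by blast
    moreover have "e m \<in> G m'" using that unfolding G_def by blast
    ultimately show "G m \<noteq> G m'" by blast
  qed
  define s where "s k = card (supp (common star k))" for k
  have "C * (card R + 1) \<le> card (Int_Phi (6 * t + w))"
  proof (rule card_ge_two_chains[where s = s and n = "\<lambda>k m. card (common (G m) k)"])
    show "finite (Int_Phi (6 * t + w))" by (rule Int_Phi_bound)
    have "s k = card (supp (common (G m) k))" for k m
      unfolding s_def supp_common[OF order_refl] supp_common[OF star] ..
    then show "(s k, card (common (G m) k)) \<in> Int_Phi (6 * t + w)" for k m
      using Phi_common[of "G m" k] by (simp add: Phi_def)
    show "s k < s k'" if "k < k'" "k' < C" for k k'
      unfolding s_def by (rule card_supp_common_less) (use that in auto)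
    show "card (common (G m) k) < card (common (G m') k)" if "m < m'" "m' < card R + 1" for k m m'
      by (rule psubset_card_mono[OF finite_common common_strict_mono])
        (use that G_less Gpairs in auto)
  qed
  then show ?thesis unfolding R(2) .
qed

end

section \<open>Decompositions of the leftover components\<close>

text \<open>For \<open>E = 1\<close> the component is the complete graph on 7 points, or the one on 9 points
without the triangle at infinity: the lists are Fano planes, and affine planes of order 3
without a line. For \<open>E = 2\<close> the components have 13 and 15 points, and their decompositions were
found by an exact cover search.\<close>

definition odd_w1 :: "nat list list" where
  "odd_w1 = [[0,3,8],[0,4,5],[0,6,7],[3,4,7],[3,5,6],[4,6,8],[5,7,8]]"
definition odd_w1' :: "nat list list" where
  "odd_w1' = [[0,3,7],[0,4,6],[0,5,8],[3,4,5],[3,6,8],[4,7,8],[5,6,7]]"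
definition odd_w3 :: "nat list list" where
  "odd_w3 = [[0,3,4],[0,5,6],[0,7,8],[1,3,5],[1,4,8],[1,6,7],[2,3,7],[2,4,6],[2,5,8],[3,6,8],[4,5,7]]"
definition odd_w3' :: "nat list list" where
  "odd_w3' = [[0,3,7],[0,4,6],[0,5,8],[1,3,4],[1,5,7],[1,6,8],[2,3,8],[2,4,5],[2,6,7],[3,5,6],[4,7,8]]"
definition even_w1 :: "nat list list" where
  "even_w1 = [[0,3,8],[0,4,6],[0,5,7],[0,9,14],[0,10,12],[0,11,13],[3,4,5],[3,6,10],[3,11,14],
     [4,7,11],[4,9,12],[5,8,9],[5,10,13],[9,10,11]]"
definition even_w1' :: "nat list list" where
  "even_w1' = [[0,3,14],[0,4,6],[0,5,13],[0,7,11],[0,8,9],[0,10,12],[3,4,11],[3,5,8],[3,6,10],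
     [4,5,7],[4,9,12],[5,9,10],[9,11,14],[10,11,13]]"
definition even_w3 :: "nat list list" where
  "even_w3 = [[0,3,6],[0,4,7],[0,5,8],[0,9,12],[0,10,13],[0,11,14],[1,3,8],[1,4,6],[1,5,13],[1,7,11],
     [1,9,14],[1,10,12],[2,3,14],[2,4,12],[2,5,7],[2,6,10],[2,8,9],[2,11,13],[3,4,11],[3,5,10],
     [4,5,9],[9,10,11]]"
definition even_w3' :: "nat list list" where
  "even_w3' = [[0,3,8],[0,4,6],[0,5,13],[0,7,11],[0,9,14],[0,10,12],[1,3,14],[1,4,12],[1,5,7],[1,6,10],
     [1,8,9],[1,11,13],[2,3,6],[2,4,7],[2,5,8],[2,9,12],[2,10,13],[2,11,14],[3,4,5],[3,10,11],
     [4,9,11],[5,9,10]]"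

definition odd_g :: "bool \<Rightarrow> nat \<times> bool" where "odd_g c = (0, c)"
definition even_g :: "bool \<Rightarrow> nat \<times> bool" where "even_g c = (of_bool c, False)"

lemma decomposition_odd_w1: "leftover_decomposition 1 1 odd_g odd_w1"
  by code_simp

lemma decomposition_odd_w1': "leftover_decomposition 1 1 odd_g odd_w1'"
  by code_simp

lemma differ_odd_w1:
  "\<forall>b\<in>set odd_w1. \<forall>b'\<in>set odd_w1'. local_point 2 0 False \<in> set b \<longrightarrow> set b \<noteq> set b'"
  by code_simp

lemma decomposition_odd_w3: "leftover_decomposition 3 1 odd_g odd_w3"
  by code_simp

lemma decomposition_odd_w3': "leftover_decomposition 3 1 odd_g odd_w3'"
  by code_simp

lemma differ_odd_w3:
  "\<forall>b\<in>set odd_w3. \<forall>b'\<in>set odd_w3'. local_point 2 0 False \<in> set b \<longrightarrow> set b \<noteq> set b'"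
  by code_simp

lemma decomposition_even_w1: "leftover_decomposition 1 2 even_g even_w1"
  by code_simp

lemma decomposition_even_w1': "leftover_decomposition 1 2 even_g even_w1'"
  by code_simp

lemma differ_even_w1:
  "\<forall>b\<in>set even_w1. \<forall>b'\<in>set even_w1'. local_point 2 0 False \<in> set b \<longrightarrow> set b \<noteq> set b'"
  by code_simp

lemma decomposition_even_w3: "leftover_decomposition 3 2 even_g even_w3"
  by code_simp

lemma decomposition_even_w3': "leftover_decomposition 3 2 even_g even_w3'"
  by code_simp

lemma differ_even_w3:
  "\<forall>b\<in>set even_w3. \<forall>b'\<in>set even_w3'. local_point 2 0 False \<in> set b \<longrightarrow> set b \<noteq> set b'"
  by code_simp

text \<open>For odd \<open>t\<close> the sum is halved, so that index \<open>i\<close> misses both points over \<open>i\<close> itself. For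
\<open>t = 2 * s\<close>, doubling modulo \<open>t\<close> hits each even number twice, and the points with bit \<open>False\<close>
over \<open>i\<close> and \<open>i + s\<close> are made the targets of the sum \<open>2 * i\<close>; the odd sums go to the points
with bit \<open>True\<close>. This is the half-idempotent quasigroup of Skolem's construction, up to
twists.\<close>

definition odd_T :: "nat \<Rightarrow> nat \<Rightarrow> bool \<Rightarrow> nat \<times> bool" where
  "odd_T t u c = (u * ((t + 1) div 2) mod t, c)"

definition even_T :: "nat \<Rightarrow> nat \<Rightarrow> bool \<Rightarrow> nat \<times> bool" where
  "even_T s u c = (u div 2 + (if c then s else 0), odd u)"

lemma halving_mod:
  assumes "odd (t :: nat)" shows "2 * i mod t * ((t + 1) div 2) mod t = i mod t"
proof -
  obtain n where t: "t = 2 * n + 1" using assms by (elim oddE)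
  have half: "(t + 1) div 2 = n + 1" by (simp add: t)
  have "2 * i mod t * (n + 1) mod t = 2 * i * (n + 1) mod t" by (rule mod_mult_left_eq)
  also have "2 * i * (n + 1) = i + t * i" by (simp add: t algebra_simps)
  also have "(i + t * i) mod t = i mod t" by simp
  finally show ?thesis unfolding half .
qed

lemma odd_construction:
  assumes t: "odd t" "2 \<le> t" and w: "w = 1 \<or> w = 3"
  shows "sum_construction t 1 w (odd_T t) odd_g"
proof
  show "0 < t" using t by simp
  show "2 \<le> t * 1" using t by simp
  show "fst (odd_T t u c) < t * 1" for u c using t by (simp add: odd_T_def)
  show "\<exists>u<t * 1. \<exists>c. odd_T t u c = (q, r)" if "q < t * 1" for q r
    using that t halving_mod[OF t(1), of q]
    by (intro exI[of _ "2 * q mod t"] conjI exI[of _ r]) (auto simp: odd_T_def)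
  show "odd_T t u True \<noteq> odd_T t u False" for u by (simp add: odd_T_def)
  show "fst (odd_g c) < 1" for c by (simp add: odd_g_def)
  show "odd_T t (2 * i mod (t * 1)) c = (i mod t + t * fst (odd_g c), snd (odd_g c))" for i c
    using halving_mod[OF t(1), of i] by (simp add: odd_T_def odd_g_def)
qed (use w in auto)

lemma even_construction:
  assumes s: "1 \<le> s" and w: "w = 1 \<or> w = 3"
  shows "sum_construction s 2 w (even_T s) even_g"
proof
  show "0 < s" using s by simp
  show "2 \<le> s * 2" using s by simp
  show "fst (even_T s u c) < s * 2" if "u < s * 2" for u c
  proof -
    have "u div 2 < s" using that by (simp add: less_mult_imp_div_less)
    then show ?thesis by (simp add: even_T_def)
  qed
  show "\<exists>u<s * 2. \<exists>c. even_T s u c = (q, r)" if q: "q < s * 2" for q r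
  proof (cases "q < s")
    case True
    then show ?thesis
      by (intro exI[of _ "2 * q + of_bool r"] conjI exI[of _ False]) (auto simp: even_T_def)
  next
    case False
    then show ?thesis using q
      by (intro exI[of _ "2 * (q - s) + of_bool r"] conjI exI[of _ True]) (auto simp: even_T_def)
  qed
  show "even_T s u True \<noteq> even_T s u False" for u using s by (simp add: even_T_def)
  show "fst (even_g c) < 2" for c by (simp add: even_g_def)
  show "even_T s (2 * i mod (s * 2)) c = (i mod s + s * fst (even_g c), snd (even_g c))" for i c
  proof -
    have "2 * i mod (s * 2) = 2 * (i mod s)"
      unfolding mult.commute[of s 2] by (rule mod_mult_mult1)
    then show ?thesis by (simp add: even_T_def even_g_def)
  qed
qed (use w in auto)

lemma card_Int_Phi_odd:
  assumes "odd t" "2 \<le> t" "w = 1 \<or> w = 3"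
  shows "t * (((t - 1) choose 2) + 1) \<le> card (Int_Phi (6 * t + w))"
proof -
  have "paired_construction t 1 w (odd_T t) odd_g
      (if w = 1 then odd_w1 else odd_w3) (if w = 1 then odd_w1' else odd_w3')"
    unfolding paired_construction_def paired_construction_axioms_def
    using odd_construction[OF assms] assms(3) 
      decomposition_odd_w1 decomposition_odd_w1' differ_odd_w1
      decomposition_odd_w3 decomposition_odd_w3' differ_odd_w3 by auto
  from paired_construction.card_Int_Phi_ge[OF this] show ?thesis by simp
qed

lemma card_Int_Phi_even:
  assumes "1 \<le> s" "w = 1 \<or> w = 3"
  shows "s * (((2 * s - 1) choose 2) + 1) \<le> card (Int_Phi (6 * (2 * s) + w))"
proof -
  have "paired_construction s 2 w (even_T s) even_g
      (if w = 1 then even_w1 else even_w3) (if w = 1 then even_w1' else even_w3')"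
    unfolding paired_construction_def paired_construction_axioms_def
    using even_construction[OF assms] assms(2) 
      decomposition_even_w1 decomposition_even_w1' differ_even_w1
      decomposition_even_w3 decomposition_even_w3' differ_even_w3 by auto
  from paired_construction.card_Int_Phi_ge[OF this] show ?thesis by (simp add: mult.commute)
qed

section \<open>The cubic growth\<close>

lemma Int_Phi_lower_bound:
  assumes t: "2 \<le> t" and w: "w = 1 \<or> w = 3"
  shows "t ^ 3 \<le> 16 * card (Int_Phi (6 * t + w))"
proof -
  define N where "N = ((t - 1) choose 2) + 1"
  have cards: "t * N \<le> 2 * card (Int_Phi (6 * t + w))"
  proof (cases "even t")
    case True
    then obtain s where s: "t = 2 * s" by (elim evenE)
    then have "s * N \<le> card (Int_Phi (6 * t + w))"
      using card_Int_Phi_even[of s w] t w by (simp add: N_def)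
    then show ?thesis by (simp add: s)
  next
    case False
    then show ?thesis using card_Int_Phi_odd[of t w] t w by (simp add: N_def)
  qed
  have square: "t ^ 2 \<le> 8 * N"
  proof -
    obtain n where n: "t = n + 2" using t by (metis add.commute le_Suc_ex)
    have "even ((n + 1) * n)" by simp
    then have "2 * ((t - 1) choose 2) = (n + 1) * n" by (simp add: n choose_two)
    then have N: "8 * N = 4 * ((n + 1) * n) + 8" by (simp add: N_def)
    have "n \<le> n * n" by simp
    then show ?thesis unfolding N n by (simp add: power2_eq_square algebra_simps)
  qed
  have "t ^ 3 = t * t ^ 2" by (simp add: power3_eq_cube power2_eq_square)
  also have "\<dots> \<le> t * (8 * N)" using square by (rule mult_le_mono2)
  also have "\<dots> = 8 * (t * N)" by simp
  also have "\<dots> \<le> 8 * (2 * card (Int_Phi (6 * t + w)))" using cards by (rule mult_le_mono2)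
  finally show ?thesis by simp
qed

theorem mainTheorem1:
  shows "\<exists>(c\<^sub>1::real) (c\<^sub>2::real) (v\<^sub>0::nat). c\<^sub>1 > 0 \<and> c\<^sub>2 > 0 \<and>
    (\<forall>v::nat. v \<ge> v\<^sub>0 \<and> (v mod 6 = 1 \<or> v mod 6 = 3) \<longrightarrow>
      c\<^sub>1 * real v ^ 3 \<le> real (card (Int_Phi v)) \<and>
      real (card (Int_Phi v)) \<le> c\<^sub>2 * real v ^ 3)"
proof (rule exI[of _ "1 / 11664"], rule exI[of _ 4], rule exI[of _ 13], intro conjI allI impI)
  fix v :: nat
  assume v: "13 \<le> v \<and> (v mod 6 = 1 \<or> v mod 6 = 3)"
  define t w where "t = v div 6" and "w = v mod 6"
  have vtw: "v = 6 * t + w" by (simp add: t_def w_def)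
  have t: "2 \<le> t" using v unfolding t_def by linarith
  have w: "w = 1 \<or> w = 3" using v by (simp add: w_def)
  have "v \<le> 9 * t" using vtw t w by linarith
  then have "v ^ 3 \<le> (9 * t) ^ 3" by (rule power_mono) simp
  also have "\<dots> = 729 * t ^ 3" by (simp add: power_mult_distrib)
  also have "\<dots> \<le> 729 * (16 * card (Int_Phi v))"
    using Int_Phi_lower_bound[OF t w] unfolding vtw by (rule mult_le_mono2)
  finally have "v ^ 3 \<le> 11664 * card (Int_Phi v)" by simp
  then have "real (v ^ 3) \<le> real (11664 * card (Int_Phi v))" by (rule of_nat_mono)
  then show "1 / 11664 * real v ^ 3 \<le> real (card (Int_Phi v))" by simp
  have "card (Int_Phi v) \<le> (v + 1) * (v * v + 1)" by (rule Int_Phi_bound)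
  also have "\<dots> \<le> (2 * v) * (2 * (v * v))"
  proof (rule mult_le_mono)
    show "v + 1 \<le> 2 * v" using v by linarith
    have "1 \<le> v * v" using v by simp
    then show "v * v + 1 \<le> 2 * (v * v)" by linarith
  qed
  also have "\<dots> = 4 * v ^ 3" by (simp add: power3_eq_cube)
  finally have "real (card (Int_Phi v)) \<le> real (4 * v ^ 3)" by (rule of_nat_mono)
  then show "real (card (Int_Phi v)) \<le> 4 * real v ^ 3" by simp
qed simp_all

end
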